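(* Let $\theta\in[0,\frac12]$ and let $(u_h^n,\sigma_h^n)\in L_h\times L_h$, $0\le n\le N$, be a solution of the nonlinear mixed finite element (MFE) scheme described in the context: for $n\ge 2$, $$(\mathcal{D}_tu_h^{n-\theta},v_h)-\gamma(\nabla \sigma_h^{n-\theta},\nabla v_h)+(\nabla u_h^{n-\theta},\nabla v_h)+(f^{n-\theta}(u_h),v_h)=(g^{n-\theta},v_h)\quad\forall v_h\in L_h,$$ $$(\sigma_h^{n-\theta},w_h)+(\nabla u_h^{n-\theta},\nabla w_h)=0\quad\forall w_h\in L_h,$$ with $(u_h^1,\sigma_h^1)$ determined from $(u_h^0,\sigma_h^0)$ by $$(\mathcal{D}_tu_h^{\frac12},v_h)-\gamma(\nabla \sigma_h^{\frac12},\nabla v_h)+(\nabla u_h^{\frac12},\nabla v_h)+(f^{\frac12}(u_h),v_h)=(g^{\frac12},v_h)\quad\forall v_h\in L_h,$$ $$(\sigma_h^{\frac12},w_h)+(\nabla u_h^{\frac12},\nabla w_h)=0\quad\forall w_h\in L_h.$$ Then there is a constant $C>0$, independent of $h$ and $\Delta t$, such that for $2\le n\le N$ $$\|u_h^{n}\|^2+\Delta t\sum_{k=2}^n\|\nabla u_h^{k-\theta}\|^2+\gamma\Delta t\sum_{k=2}^n\|\sigma_h^{k-\theta}\|^2\leq C\Big(\|u_h^{0}\|^2+\Delta t\sum_{k=1}^n\|g^{k}\|^2\Big).$$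
   Context: $\Omega\subset\mathbb{R}^d$, $d\le 2$, is a bounded convex polygonal domain, $J=(0,T]$ with $0<T<\infty$. The underlying problem is $u_t+\gamma\Delta^2u-\Delta u+f(u)=g(\mathbf z,t)$ in $\Omega\times J$, $u(\cdot,0)=u_0$, $u=\Delta u=0$ on $\partial\Omega\times\bar J$, where $\gamma>0$ is constant and the nonlinear term $f$ satisfies $|f(a)-f(b)|\le C|a-b|$. It is rewritten with $\sigma=\Delta u$. $(\cdot,\cdot)$ and $\|\cdot\|$ are the $L^2(\Omega)$ inner product and norm. $L_h\subset H_0^1(\Omega)$ is a finite element space on a mesh of size $h$. Time grid: $t_n=n\Delta t$, $\Delta t=T/N$, $0\le n\le N$; $g^n=g(\cdot,t_n)$. For a sequence $\{\phi^n\}$: for $n\ge2$, $\mathcal{D}_t\phi^{n-\theta}=\frac{(3-2\theta)\phi^{n}-(4-4\theta)\phi^{n-1}+(1-2\theta)\phi^{n-2}}{2\Delta t}$ and $\phi^{n-\theta}=(1-\theta)\phi^n+\theta\phi^{n-1}$; $f^{n-\theta}(\phi)=(1-\theta)f(\phi^n)+\theta f(\phi^{n-1})$. For the first step (Crank–Nicolson), $\mathcal{D}_t\phi^{\frac12}=\frac{\phi^1-\phi^0}{\Delta t}$, $\phi^{\frac12}=\frac12(\phi^1+\phi^0)$, $f^{\frac12}(\phi)=\frac12(f(\phi^1)+f(\phi^0))$.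
   Formalization: As printed the bound fails, so three changes are made: the sum of ‖g^k‖² on the right starts at k=0 instead of k=1; f(0)=0 is assumed; and the bound is claimed only for Δt ≤ τ, with τ>0 fixed independently of h, Δt, L_h, g and the solution. *)

theory Defs
  imports "HOL-Analysis.Analysis"
begin

section \<open>Lebesgue and Sobolev spaces\<close>

text \<open>Elements of \<open>L\<^sup>2(\<Omega>)\<close> are represented by functions on the whole space; only their values
  on \<open>\<Omega>\<close>, up to null sets, matter for the inner products below.\<close>

definition L2 :: "'a::euclidean_space set \<Rightarrow> ('a \<Rightarrow> 'b::euclidean_space) set" where
  "L2 \<Omega> = {u. u \<in> borel_measurable (lebesgue_on \<Omega>) \<and>
               integrable (lebesgue_on \<Omega>) (\<lambda>x. (norm (u x))\<^sup>2)}"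

definition L2_inner ::
    "'a::euclidean_space set \<Rightarrow> ('a \<Rightarrow> 'b::euclidean_space) \<Rightarrow> ('a \<Rightarrow> 'b) \<Rightarrow> real" where
  "L2_inner \<Omega> u v = (\<integral>x. u x \<bullet> v x \<partial>(lebesgue_on \<Omega>))"

definition L2_norm :: "'a::euclidean_space set \<Rightarrow> ('a \<Rightarrow> 'b::euclidean_space) \<Rightarrow> real" where
  "L2_norm \<Omega> u = sqrt (L2_inner \<Omega> u u)"

primrec Ck :: "nat \<Rightarrow> ('a::euclidean_space \<Rightarrow> real) \<Rightarrow> bool" where
  "Ck 0 \<phi> \<longleftrightarrow> continuous_on UNIV \<phi>"
| "Ck (Suc k) \<phi> \<longleftrightarrow> (\<forall>x. \<phi> differentiable (at x)) \<and>
     (\<forall>i\<in>Basis. Ck k (\<lambda>x. frechet_derivative \<phi> (at x) i))"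

definition test_functions :: "'a::euclidean_space set \<Rightarrow> ('a \<Rightarrow> real) set" where
  "test_functions \<Omega> = {\<phi>. (\<forall>k. Ck k \<phi>) \<and>
     compact (closure {x. \<phi> x \<noteq> 0}) \<and> closure {x. \<phi> x \<noteq> 0} \<subseteq> \<Omega>}"

definition weak_gradient ::
    "'a::euclidean_space set \<Rightarrow> ('a \<Rightarrow> real) \<Rightarrow> ('a \<Rightarrow> 'a) \<Rightarrow> bool" where
  "weak_gradient \<Omega> u p \<longleftrightarrow> (\<forall>\<phi>\<in>test_functions \<Omega>. \<forall>i\<in>Basis.
     L2_inner \<Omega> u (\<lambda>x. frechet_derivative \<phi> (at x) i) = - L2_inner \<Omega> (\<lambda>x. p x \<bullet> i) \<phi>)"

definition H1 :: "'a::euclidean_space set \<Rightarrow> ('a \<Rightarrow> real) set" where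
  "H1 \<Omega> = {u \<in> L2 \<Omega>. \<exists>p\<in>L2 \<Omega>. weak_gradient \<Omega> u p}"

text \<open>A representative of the weak gradient, which is unique up to null sets; meaningful
  for arguments in \<open>H1 \<Omega>\<close> only.\<close>

definition grad :: "'a::euclidean_space set \<Rightarrow> ('a \<Rightarrow> real) \<Rightarrow> ('a \<Rightarrow> 'a)" where
  "grad \<Omega> u = (SOME p. p \<in> L2 \<Omega> \<and> weak_gradient \<Omega> u p)"

definition H1_norm :: "'a::euclidean_space set \<Rightarrow> ('a \<Rightarrow> real) \<Rightarrow> real" where
  "H1_norm \<Omega> u = sqrt ((L2_norm \<Omega> u)\<^sup>2 + (L2_norm \<Omega> (grad \<Omega> u))\<^sup>2)"

text \<open>The closure of the test functions in \<open>H1 \<Omega>\<close>.\<close>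

definition H01 :: "'a::euclidean_space set \<Rightarrow> ('a \<Rightarrow> real) set" where
  "H01 \<Omega> = {u \<in> H1 \<Omega>. \<forall>\<epsilon>>0. \<exists>\<phi>\<in>test_functions \<Omega>. H1_norm \<Omega> (\<lambda>x. u x - \<phi> x) < \<epsilon>}"


section \<open>Domain and finite element spaces\<close>

definition convex_polygonal_domain :: "'a::euclidean_space set \<Rightarrow> bool" where
  "convex_polygonal_domain \<Omega> \<longleftrightarrow> \<Omega> \<noteq> {} \<and> (\<exists>P. polytope P \<and> \<Omega> = interior P)"

text \<open>The elements are arbitrary nondegenerate convex polytopes (intervals, triangles,
  quadrilaterals, ...); neither conformity nor shape regularity is required.\<close>

definition mesh_of :: "'a::euclidean_space set \<Rightarrow> real \<Rightarrow> 'a set set \<Rightarrow> bool" where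
  "mesh_of \<Omega> h M \<longleftrightarrow> finite M \<and> M \<noteq> {} \<and> \<Union>M = closure \<Omega> \<and>
     (\<forall>K\<in>M. polytope K \<and> interior K \<noteq> {}) \<and>
     (\<forall>K\<in>M. \<forall>K'\<in>M. K \<noteq> K' \<longrightarrow> interior K \<inter> interior K' = {}) \<and>
     h = Max (diameter ` M)"

text \<open>A finite-dimensional space (the span of a finite set \<open>B\<close>) of piecewise polynomial
  functions, conforming in \<open>H01 \<Omega>\<close>.\<close>

definition fe_space :: "'a::euclidean_space set \<Rightarrow> real \<Rightarrow> ('a \<Rightarrow> real) set \<Rightarrow> bool" where
  "fe_space \<Omega> h L \<longleftrightarrow> L \<subseteq> H01 \<Omega> \<and>
     (\<exists>B. finite B \<and> L = {v. \<exists>c. v = (\<lambda>x. \<Sum>b\<in>B. c b * b x)}) \<and>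
     (\<exists>M. mesh_of \<Omega> h M \<and>
        (\<forall>v\<in>L. \<forall>K\<in>M. \<exists>p. real_polynomial_function p \<and> (\<forall>x\<in>K. v x = p x)))"


section \<open>Time discretisation and the fully discrete scheme\<close>

definition Dt_theta :: "real \<Rightarrow> real \<Rightarrow> (nat \<Rightarrow> 'a \<Rightarrow> real) \<Rightarrow> nat \<Rightarrow> 'a \<Rightarrow> real" where
  "Dt_theta \<theta> dt \<phi> n =
     (\<lambda>x. ((3 - 2*\<theta>) * \<phi> n x - (4 - 4*\<theta>) * \<phi> (n-1) x + (1 - 2*\<theta>) * \<phi> (n-2) x) / (2 * dt))"

definition at_theta :: "real \<Rightarrow> (nat \<Rightarrow> 'a \<Rightarrow> real) \<Rightarrow> nat \<Rightarrow> 'a \<Rightarrow> real" where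
  "at_theta \<theta> \<phi> n = (\<lambda>x. (1 - \<theta>) * \<phi> n x + \<theta> * \<phi> (n-1) x)"

definition Dt_half :: "real \<Rightarrow> (nat \<Rightarrow> 'a \<Rightarrow> real) \<Rightarrow> 'a \<Rightarrow> real" where
  "Dt_half dt \<phi> = (\<lambda>x. (\<phi> 1 x - \<phi> 0 x) / dt)"

definition at_half :: "(nat \<Rightarrow> 'a \<Rightarrow> real) \<Rightarrow> 'a \<Rightarrow> real" where
  "at_half \<phi> = (\<lambda>x. (\<phi> 1 x + \<phi> 0 x) / 2)"

definition at_times :: "('a \<Rightarrow> real \<Rightarrow> real) \<Rightarrow> real \<Rightarrow> nat \<Rightarrow> 'a \<Rightarrow> real" where
  "at_times g dt n = (\<lambda>x. g x (real n * dt))"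

text \<open>The averages of the nonlinear term are those of the sequence \<open>n \<mapsto> f \<circ> u n\<close>:
  \<open>f\<close> is applied before averaging.\<close>

definition MFE_solution ::
    "'a::euclidean_space set \<Rightarrow> ('a \<Rightarrow> real) set \<Rightarrow> real \<Rightarrow> real \<Rightarrow> (real \<Rightarrow> real) \<Rightarrow>
     ('a \<Rightarrow> real \<Rightarrow> real) \<Rightarrow> real \<Rightarrow> nat \<Rightarrow> (nat \<Rightarrow> 'a \<Rightarrow> real) \<Rightarrow> (nat \<Rightarrow> 'a \<Rightarrow> real) \<Rightarrow> bool" where
  "MFE_solution \<Omega> L \<theta> \<gamma> f g dt N u \<sigma> \<longleftrightarrow>
     (\<forall>n\<le>N. u n \<in> L \<and> \<sigma> n \<in> L) \<and>
     (\<forall>v\<in>L. L2_inner \<Omega> (Dt_half dt u) v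
        - \<gamma> * L2_inner \<Omega> (grad \<Omega> (at_half \<sigma>)) (grad \<Omega> v)
        + L2_inner \<Omega> (grad \<Omega> (at_half u)) (grad \<Omega> v)
        + L2_inner \<Omega> (at_half (\<lambda>n. f \<circ> u n)) v
        = L2_inner \<Omega> (at_half (at_times g dt)) v) \<and>
     (\<forall>w\<in>L. L2_inner \<Omega> (at_half \<sigma>) w + L2_inner \<Omega> (grad \<Omega> (at_half u)) (grad \<Omega> w) = 0) \<and>
     (\<forall>n\<in>{2..N}.
       (\<forall>v\<in>L. L2_inner \<Omega> (Dt_theta \<theta> dt u n) v
          - \<gamma> * L2_inner \<Omega> (grad \<Omega> (at_theta \<theta> \<sigma> n)) (grad \<Omega> v)
          + L2_inner \<Omega> (grad \<Omega> (at_theta \<theta> u n)) (grad \<Omega> v)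
          + L2_inner \<Omega> (at_theta \<theta> (\<lambda>m. f \<circ> u m) n) v
          = L2_inner \<Omega> (at_theta \<theta> (at_times g dt) n) v) \<and>
       (\<forall>w\<in>L. L2_inner \<Omega> (at_theta \<theta> \<sigma> n) w
          + L2_inner \<Omega> (grad \<Omega> (at_theta \<theta> u n)) (grad \<Omega> w) = 0))"

end

theory Submission
  imports Defs
begin

text \<open>
  Testing the two equations with \<open>u\<^sup>n\<^sup>-\<^sup>\<theta>\<close> and \<open>\<sigma>\<^sup>n\<^sup>-\<^sup>\<theta>\<close> makes the mixed gradient terms cancel, leaving
  \<open>(\<D>\<^sub>t u, u) + \<gamma> \<parallel>\<sigma>\<parallel>\<^sup>2 + \<parallel>\<nabla>u\<parallel>\<^sup>2 = (g - f, u)\<close>. The scheme is G-stable: the first term dominates the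
  increment, divided by \<open>4\<Delta>t\<close>, of a quadratic form in two consecutive iterates that bounds
  \<open>\<parallel>u\<^sup>n\<parallel>\<^sup>2\<close> from above. A discrete Gronwall argument for this form, started by the same energy
  argument for the Crank-Nicolson step, gives the estimate.
\<close>

section \<open>Square-integrable functions and the inner product\<close>

lemma L2_integrable_mult:
  fixes u v :: "'a::euclidean_space \<Rightarrow> real"
  assumes "u \<in> L2 \<Omega>" "v \<in> L2 \<Omega>"
  shows "integrable (lebesgue_on \<Omega>) (\<lambda>x. u x * v x)"
proof (rule Bochner_Integration.integrable_bound)
  show "integrable (lebesgue_on \<Omega>) (\<lambda>x. (u x)\<^sup>2 + (v x)\<^sup>2)"
    using assms by (simp add: L2_def)
  show "(\<lambda>x. u x * v x) \<in> borel_measurable (lebesgue_on \<Omega>)"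
    using assms by (auto simp: L2_def intro: borel_measurable_times)
  have "\<bar>a * b\<bar> \<le> a\<^sup>2 + b\<^sup>2" for a b :: real
  proof -
    have "2 * (\<bar>a\<bar> * \<bar>b\<bar>) \<le> a\<^sup>2 + b\<^sup>2"
      using sum_squares_bound[of "\<bar>a\<bar>" "\<bar>b\<bar>"] by simp
    moreover have "0 \<le> \<bar>a\<bar> * \<bar>b\<bar>"
      by simp
    ultimately show ?thesis
      unfolding abs_mult by linarith
  qed
  then show "AE x in lebesgue_on \<Omega>. norm (u x * v x) \<le> norm ((u x)\<^sup>2 + (v x)\<^sup>2)"
    by simp
qed

lemma L2_lincomb:
  fixes u v :: "'a::euclidean_space \<Rightarrow> real"
  assumes "u \<in> L2 \<Omega>" "v \<in> L2 \<Omega>"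
  shows "(\<lambda>x. r * u x + s * v x) \<in> L2 \<Omega>"
proof -
  have "integrable (lebesgue_on \<Omega>)
      (\<lambda>x. r\<^sup>2 * (u x * u x) + 2 * r * s * (u x * v x) + s\<^sup>2 * (v x * v x))"
    by (intro Bochner_Integration.integrable_add integrable_mult_right L2_integrable_mult assms)
  moreover have "(\<lambda>x. r\<^sup>2 * (u x * u x) + 2 * r * s * (u x * v x) + s\<^sup>2 * (v x * v x))
      = (\<lambda>x. (r * u x + s * v x)\<^sup>2)"
    by (auto simp: power2_eq_square algebra_simps)
  moreover have "(\<lambda>x. r * u x + s * v x) \<in> borel_measurable (lebesgue_on \<Omega>)"
    using assms by (auto simp: L2_def intro!: borel_measurable_add borel_measurable_times)
  ultimately show ?thesis
    by (simp add: L2_def)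
qed

text \<open>With \<open>f 0 = 0\<close> the Lipschitz bound against zero reads |f(a)| \<le> K |a|,
  so the square of \<open>f \<circ> u\<close> is dominated by \<open>K\<^sup>2\<close> times that of
  \<open>u\<close>. Measurability follows from the continuity of \<open>f\<close>.\<close>

lemma L2_lipschitz_comp:
  fixes u :: "'a::euclidean_space \<Rightarrow> real" and f :: "real \<Rightarrow> real"
  assumes u: "u \<in> L2 \<Omega>"
    and lip: "\<And>a b. \<bar>f a - f b\<bar> \<le> K * \<bar>a - b\<bar>" and f0: "f 0 = 0"
  shows "f \<circ> u \<in> L2 \<Omega>"
proof -
  have K: "0 \<le> K"
    using lip[of 1 0] by simp
  have "K-lipschitz_on UNIV f"
    using lip K by (auto simp: lipschitz_on_def dist_real_def)
  then have "f \<in> borel_measurable borel"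
    by (intro borel_measurable_continuous_onI lipschitz_on_continuous_on)
  then have meas: "f \<circ> u \<in> borel_measurable (lebesgue_on \<Omega>)"
    using u by (auto simp: L2_def intro: measurable_comp)
  have "integrable (lebesgue_on \<Omega>) (\<lambda>x. (f (u x))\<^sup>2)"
  proof (rule Bochner_Integration.integrable_bound)
    show "integrable (lebesgue_on \<Omega>) (\<lambda>x. K\<^sup>2 * (u x)\<^sup>2)"
      using u by (simp add: L2_def)
    show "(\<lambda>x. (f (u x))\<^sup>2) \<in> borel_measurable (lebesgue_on \<Omega>)"
      using meas by (simp add: comp_def)
    have "(f a)\<^sup>2 \<le> K\<^sup>2 * a\<^sup>2" for a
      using lip[of a 0] f0 K abs_le_square_iff[of "f a" "K * a"]
      by (simp add: abs_mult power_mult_distrib)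
    then show "AE x in lebesgue_on \<Omega>. norm ((f (u x))\<^sup>2) \<le> norm (K\<^sup>2 * (u x)\<^sup>2)"
      by simp
  qed
  then show ?thesis
    using meas by (simp add: L2_def)
qed

text \<open>Holds for every \<open>u\<close>: the integrand is nonnegative, and the Bochner integral
  takes the value 0 where it is not integrable, so the square root is always undone.\<close>

lemma L2_norm_power2: "(L2_norm \<Omega> u)\<^sup>2 = L2_inner \<Omega> u u"
  by (simp add: L2_norm_def L2_inner_def)

lemma L2_inner_commute: "L2_inner \<Omega> u v = L2_inner \<Omega> v u"
  by (simp add: L2_inner_def inner_commute)

text \<open>Makes the time averages of discrete solutions admissible as test functions: the space is
  a span, and coefficients combine linearly.\<close>

lemma fe_space_lincomb:
  assumes "fe_space \<Omega> h L" "u \<in> L" "v \<in> L"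
  shows "(\<lambda>x. r * u x + s * v x) \<in> L"
proof -
  obtain B where L: "L = {v. \<exists>c. v = (\<lambda>x. \<Sum>b\<in>B. c b * b x)}"
    using assms(1) by (auto simp: fe_space_def)
  obtain c d where "u = (\<lambda>x. \<Sum>b\<in>B. c b * b x)" "v = (\<lambda>x. \<Sum>b\<in>B. d b * b x)"
    using assms(2,3) L by auto
  then have "(\<lambda>x. r * u x + s * v x) = (\<lambda>x. \<Sum>b\<in>B. (r * c b + s * d b) * b x)"
    by (simp add: sum_distrib_left sum.distrib algebra_simps)
  then show ?thesis
    unfolding L by (auto intro: exI[of _ "\<lambda>b. r * c b + s * d b"])
qed

lemma fe_space_subset_L2: "fe_space \<Omega> h L \<Longrightarrow> L \<subseteq> L2 \<Omega>"
  by (auto simp: fe_space_def H01_def H1_def)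

section \<open>G-stability of the two-step formula\<close>

text \<open>The Lyapunov form of the two-step formula, with \<open>a\<close> the newer and
  \<open>b\<close> the older value. For \<theta> = 0 it is
  \<open>a\<^sup>2 + (2*a - b)\<^sup>2\<close>, the classical form for BDF2; for \<theta> = 1/2 it
  reduces to \<open>2 * a\<^sup>2\<close>, as suits Crank-Nicolson.\<close>

definition G_form :: "real \<Rightarrow> real \<Rightarrow> real \<Rightarrow> real" where
  "G_form \<theta> a b = (3 - 2*\<theta>) * a\<^sup>2 - (1 - 2*\<theta>) * b\<^sup>2 + (2 - \<theta>) * (1 - 2*\<theta>) * (a - b)\<^sup>2"

text \<open>The negative coefficient in front of \<open>b\<^sup>2\<close> is only apparent:
  completing the square in \<open>b\<close>, after multiplication by the positive number
  \<open>1 - \<theta>\<close>, leaves a sum of nonnegative terms.\<close>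

lemma G_form_ge:
  assumes "0 \<le> \<theta>" "\<theta> \<le> 1/2"
  shows "a\<^sup>2 \<le> G_form \<theta> a b"
proof -
  have "(1 - \<theta>) * (G_form \<theta> a b - a\<^sup>2)
      = \<theta> * a\<^sup>2 + (1 - 2*\<theta>) * ((1 - \<theta>) * b - (2 - \<theta>) * a)\<^sup>2"
    by (simp add: G_form_def power2_eq_square algebra_simps)
  also have "\<dots> \<ge> 0"
    using assms by simp
  finally show ?thesis
    using assms by (simp add: zero_le_mult_iff)
qed

lemma G_form_le:
  assumes "0 \<le> \<theta>" "\<theta> \<le> 1/2"
  shows "G_form \<theta> a b \<le> 7 * (a\<^sup>2 + b\<^sup>2)"
proof -
  \<comment> \<open>The constant 7 is 3 + 2 * 2: at most 3 from the first coefficient, and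
    \<open>P\<close> contributes at most \<open>4 * a\<^sup>2 + 4 * b\<^sup>2\<close>. The term
    \<open>Q\<close> enters with a favourable sign.\<close>
  define P Q where "P = (2 - \<theta>) * (1 - 2*\<theta>) * (a - b)\<^sup>2" and "Q = (1 - 2*\<theta>) * b\<^sup>2"
  have "(2 - \<theta>) * (1 - 2*\<theta>) \<le> 2 * 1"
    using assms by (intro mult_mono) auto
  then have "P \<le> 2 * (a - b)\<^sup>2"
    unfolding P_def by (intro mult_right_mono) auto
  moreover have "(a - b)\<^sup>2 \<le> 2 * a\<^sup>2 + 2 * b\<^sup>2"
    using zero_le_power2[of "a + b"] by (simp add: power2_eq_square algebra_simps)
  moreover have "0 \<le> Q" "0 \<le> b\<^sup>2"
    using assms by (auto simp: Q_def)
  moreover have "(3 - 2*\<theta>) * a\<^sup>2 \<le> 3 * a\<^sup>2"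
    using assms by (intro mult_right_mono) auto
  moreover have "G_form \<theta> a b = (3 - 2*\<theta>) * a\<^sup>2 - Q + P"
    by (simp add: G_form_def P_def Q_def)
  ultimately show ?thesis
    unfolding distrib_left by linarith
qed

text \<open>The G-stability identity for three consecutive values \<open>a\<close>,
  \<open>b\<close>, \<open>c\<close>, newest first. The defect is a multiple of the squared second
  difference, a numerical dissipation whose sign requires \<theta> \<le> 1/2.\<close>

lemma G_form_increment_le:
  assumes "0 \<le> \<theta>" "\<theta> \<le> 1/2"
  shows "G_form \<theta> a b - G_form \<theta> b c
    \<le> 2 * ((3 - 2*\<theta>) * a - (4 - 4*\<theta>) * b + (1 - 2*\<theta>) * c) * ((1 - \<theta>) * a + \<theta> * b)"
proof -
  have "2 * ((3 - 2*\<theta>) * a - (4 - 4*\<theta>) * b + (1 - 2*\<theta>) * c) * ((1 - \<theta>) * a + \<theta> * b)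
      - (G_form \<theta> a b - G_form \<theta> b c) = (1 - \<theta>) * (1 - 2*\<theta>) * (a - 2*b + c)\<^sup>2"
    by (simp add: G_form_def power2_eq_square algebra_simps)
  also have "\<dots> \<ge> 0"
    using assms by simp
  finally show ?thesis
    by simp
qed

section \<open>Bounds for the source and the nonlinear term\<close>

lemma convex_comb_square_le:
  fixes a b :: real
  assumes "0 \<le> \<theta>" "\<theta> \<le> 1"
  shows "((1 - \<theta>) * a + \<theta> * b)\<^sup>2 \<le> a\<^sup>2 + b\<^sup>2"
proof -
  have "a\<^sup>2 + b\<^sup>2 - ((1 - \<theta>) * a + \<theta> * b)\<^sup>2
      = \<theta> * a\<^sup>2 + (1 - \<theta>) * b\<^sup>2 + \<theta> * (1 - \<theta>) * (a - b)\<^sup>2"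
    by (simp add: power2_eq_square algebra_simps)
  also have "\<dots> \<ge> 0"
    using assms by simp
  finally show ?thesis
    by simp
qed

text \<open>Young's inequality for the source part and the Lipschitz bound for the nonlinear part.
  The estimate is pointwise, so that monotonicity of the integral carries it over to norms.\<close>

lemma source_term_le:
  fixes f :: "real \<Rightarrow> real"
  assumes \<theta>: "0 \<le> \<theta>" "\<theta> \<le> 1"
    and lip: "\<And>a b. \<bar>f a - f b\<bar> \<le> K * \<bar>a - b\<bar>" and f0: "f 0 = 0"
  shows "((1 - \<theta>) * p + \<theta> * q - ((1 - \<theta>) * f a + \<theta> * f b)) * ((1 - \<theta>) * a + \<theta> * b)
    \<le> (K + 1) * (a\<^sup>2 + b\<^sup>2 + p\<^sup>2 + q\<^sup>2)"
proof -
  define U G F where "U = (1 - \<theta>) * a + \<theta> * b" and "G = (1 - \<theta>) * p + \<theta> * q"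
    and "F = (1 - \<theta>) * f a + \<theta> * f b"
  \<comment> \<open>The average of absolute values majorises both factors, |U| by \<open>A\<close>
    and |F| by \<open>K * A\<close>; their product is then \<open>K\<close> times the square of one
    convex combination.\<close>
  define A where "A = (1 - \<theta>) * \<bar>a\<bar> + \<theta> * \<bar>b\<bar>"
  have K: "0 \<le> K"
    using lip[of 1 0] by simp
  have f: "\<bar>f a\<bar> \<le> K * \<bar>a\<bar>" for a
    using lip[of a 0] f0 by simp
  have "\<bar>F\<bar> \<le> (1 - \<theta>) * \<bar>f a\<bar> + \<theta> * \<bar>f b\<bar>"
    unfolding F_def using \<theta> by (intro order_trans[OF abs_triangle_ineq]) (simp add: abs_mult)
  also have "\<dots> \<le> (1 - \<theta>) * (K * \<bar>a\<bar>) + \<theta> * (K * \<bar>b\<bar>)"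
    using \<theta> f by (intro add_mono mult_left_mono) auto
  finally have F: "\<bar>F\<bar> \<le> K * A"
    by (simp add: A_def algebra_simps)
  have U: "\<bar>U\<bar> \<le> A"
    unfolding A_def U_def using \<theta>
    by (intro order_trans[OF abs_triangle_ineq]) (simp add: abs_mult)
  have "- F * U \<le> \<bar>F\<bar> * \<bar>U\<bar>"
    by (metis abs_ge_self abs_minus_cancel abs_mult)
  also have "\<dots> \<le> K * A * A"
    using F U K by (intro mult_mono) auto
  also have "\<dots> = K * A\<^sup>2"
    by (simp add: power2_eq_square)
  also have "\<dots> \<le> K * (a\<^sup>2 + b\<^sup>2)"
    using convex_comb_square_le[OF \<theta>, of "\<bar>a\<bar>" "\<bar>b\<bar>"] K
    by (intro mult_left_mono) (simp_all add: A_def)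
  finally have 1: "- F * U \<le> K * (a\<^sup>2 + b\<^sup>2)" .
  have 2: "2 * (G * U) \<le> (p\<^sup>2 + q\<^sup>2) + (a\<^sup>2 + b\<^sup>2)"
    using sum_squares_bound[of G U] convex_comb_square_le[OF \<theta>, of p q]
      convex_comb_square_le[OF \<theta>, of a b]
    unfolding U_def[symmetric] G_def[symmetric] mult.assoc by linarith
  have "0 \<le> K * (p\<^sup>2 + q\<^sup>2)" "0 \<le> a\<^sup>2 + b\<^sup>2" "0 \<le> p\<^sup>2 + q\<^sup>2"
    using K by auto
  moreover have "(K + 1) * (a\<^sup>2 + b\<^sup>2 + p\<^sup>2 + q\<^sup>2)
      = K * (a\<^sup>2 + b\<^sup>2) + K * (p\<^sup>2 + q\<^sup>2) + (a\<^sup>2 + b\<^sup>2) + (p\<^sup>2 + q\<^sup>2)"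
    by (simp add: algebra_simps)
  moreover have "(G - F) * U = G * U + - F * U"
    by (simp add: algebra_simps)
  ultimately have "(G - F) * U \<le> (K + 1) * (a\<^sup>2 + b\<^sup>2 + p\<^sup>2 + q\<^sup>2)"
    using 1 2 by linarith
  then show ?thesis
    by (simp add: U_def G_def F_def)
qed

text \<open>Stated for \<theta> up to 1 and four separate functions, so that it serves the general
  step and, with \<theta> = 1/2, the Crank-Nicolson step.\<close>

lemma source_integral_le:
  fixes u v p q :: "'a::euclidean_space \<Rightarrow> real"
  assumes \<theta>: "0 \<le> \<theta>" "\<theta> \<le> 1"
    and lip: "\<And>a b. \<bar>f a - f b\<bar> \<le> K * \<bar>a - b\<bar>" and f0: "f 0 = 0"
    and mem: "u \<in> L2 \<Omega>" "v \<in> L2 \<Omega>" "p \<in> L2 \<Omega>" "q \<in> L2 \<Omega>"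
  shows "L2_inner \<Omega> (\<lambda>x. (1 - \<theta>) * p x + \<theta> * q x) (\<lambda>x. (1 - \<theta>) * u x + \<theta> * v x)
      - L2_inner \<Omega> (\<lambda>x. (1 - \<theta>) * (f \<circ> u) x + \<theta> * (f \<circ> v) x) (\<lambda>x. (1 - \<theta>) * u x + \<theta> * v x)
    \<le> (K + 1) * ((L2_norm \<Omega> u)\<^sup>2 + (L2_norm \<Omega> v)\<^sup>2 + (L2_norm \<Omega> p)\<^sup>2 + (L2_norm \<Omega> q)\<^sup>2)"
proof -
  let ?G = "\<lambda>x. (1 - \<theta>) * p x + \<theta> * q x"
  let ?F = "\<lambda>x. (1 - \<theta>) * (f \<circ> u) x + \<theta> * (f \<circ> v) x"
  let ?U = "\<lambda>x. (1 - \<theta>) * u x + \<theta> * v x"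
  have fmem: "f \<circ> u \<in> L2 \<Omega>" "f \<circ> v \<in> L2 \<Omega>"
    using L2_lipschitz_comp[OF _ lip f0] mem by auto
  have in_L2: "?G \<in> L2 \<Omega>" "?F \<in> L2 \<Omega>" "?U \<in> L2 \<Omega>"
    by (intro L2_lincomb mem fmem)+
  have sq: "integrable (lebesgue_on \<Omega>) (\<lambda>x. (w x)\<^sup>2)" if "w \<in> L2 \<Omega>" for w :: "'a \<Rightarrow> real"
    using that by (simp add: L2_def)
  have "L2_inner \<Omega> ?G ?U - L2_inner \<Omega> ?F ?U = (\<integral>x. ?G x * ?U x - ?F x * ?U x \<partial>lebesgue_on \<Omega>)"
    unfolding L2_inner_def inner_real_def
    by (intro Bochner_Integration.integral_diff[symmetric] L2_integrable_mult in_L2)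
  also have "\<dots> \<le> (\<integral>x. (K + 1) * ((u x)\<^sup>2 + (v x)\<^sup>2 + (p x)\<^sup>2 + (q x)\<^sup>2) \<partial>lebesgue_on \<Omega>)"
  proof (rule integral_mono)
    show "integrable (lebesgue_on \<Omega>) (\<lambda>x. ?G x * ?U x - ?F x * ?U x)"
      by (intro Bochner_Integration.integrable_diff L2_integrable_mult in_L2)
    show "integrable (lebesgue_on \<Omega>) (\<lambda>x. (K + 1) * ((u x)\<^sup>2 + (v x)\<^sup>2 + (p x)\<^sup>2 + (q x)\<^sup>2))"
      by (intro integrable_mult_right Bochner_Integration.integrable_add sq mem)
    show "?G x * ?U x - ?F x * ?U x \<le> (K + 1) * ((u x)\<^sup>2 + (v x)\<^sup>2 + (p x)\<^sup>2 + (q x)\<^sup>2)" for x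
      using source_term_le[OF \<theta> lip f0, of "p x" "q x" "u x" "v x"]
      by (simp add: left_diff_distrib)
  qed
  also have "\<dots> = (K + 1) * ((L2_norm \<Omega> u)\<^sup>2 + (L2_norm \<Omega> v)\<^sup>2 + (L2_norm \<Omega> p)\<^sup>2 + (L2_norm \<Omega> q)\<^sup>2)"
    using mem by (simp add: L2_norm_power2 L2_inner_def sq flip: power2_eq_square)
  finally show ?thesis .
qed

section \<open>Energies of the iterates\<close>

text \<open>Defined as one integral instead of a combination of norms, so that each pointwise
  inequality for \<open>G_form\<close> transfers by monotonicity.\<close>

definition G_energy :: "'a::euclidean_space set \<Rightarrow> real \<Rightarrow> ('a \<Rightarrow> real) \<Rightarrow> ('a \<Rightarrow> real) \<Rightarrow> real" where
  "G_energy \<Omega> \<theta> u v = (\<integral>x. G_form \<theta> (u x) (v x) \<partial>lebesgue_on \<Omega>)"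

lemma integrable_G_form:
  fixes u v :: "'a::euclidean_space \<Rightarrow> real"
  assumes "u \<in> L2 \<Omega>" "v \<in> L2 \<Omega>"
  shows "integrable (lebesgue_on \<Omega>) (\<lambda>x. G_form \<theta> (u x) (v x))"
proof -
  have "(\<lambda>x. 1 * u x + (-1) * v x) \<in> L2 \<Omega>"
    by (rule L2_lincomb[OF assms])
  then have "(\<lambda>x. u x - v x) \<in> L2 \<Omega>"
    by simp
  then show ?thesis
    using assms by (simp add: G_form_def L2_def)
qed

lemma G_energy_ge:
  fixes u v :: "'a::euclidean_space \<Rightarrow> real"
  assumes "0 \<le> \<theta>" "\<theta> \<le> 1/2" "u \<in> L2 \<Omega>" "v \<in> L2 \<Omega>"
  shows "(L2_norm \<Omega> u)\<^sup>2 \<le> G_energy \<Omega> \<theta> u v"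
  unfolding L2_norm_power2 L2_inner_def G_energy_def inner_real_def
  using assms G_form_ge[OF assms(1,2)]
  by (intro integral_mono L2_integrable_mult integrable_G_form) (auto simp: power2_eq_square)

lemma G_energy_le:
  fixes u v :: "'a::euclidean_space \<Rightarrow> real"
  assumes "0 \<le> \<theta>" "\<theta> \<le> 1/2" "u \<in> L2 \<Omega>" "v \<in> L2 \<Omega>"
  shows "G_energy \<Omega> \<theta> u v \<le> 7 * ((L2_norm \<Omega> u)\<^sup>2 + (L2_norm \<Omega> v)\<^sup>2)"
proof -
  have "G_energy \<Omega> \<theta> u v \<le> (\<integral>x. 7 * (u x * u x + v x * v x) \<partial>lebesgue_on \<Omega>)"
    unfolding G_energy_def using assms G_form_le[OF assms(1,2)]
    by (intro integral_mono integrable_G_form integrable_mult_right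
        Bochner_Integration.integrable_add L2_integrable_mult) (auto simp: power2_eq_square)
  then show ?thesis
    using assms by (simp add: L2_norm_power2 L2_inner_def L2_integrable_mult)
qed

lemma G_energy_increment_le:
  fixes u :: "nat \<Rightarrow> 'a::euclidean_space \<Rightarrow> real"
  assumes "0 \<le> \<theta>" "\<theta> \<le> 1/2" "0 < dt"
    and mem: "u n \<in> L2 \<Omega>" "u (n-1) \<in> L2 \<Omega>" "u (n-2) \<in> L2 \<Omega>"
  shows "G_energy \<Omega> \<theta> (u n) (u (n-1)) - G_energy \<Omega> \<theta> (u (n-1)) (u (n-2))
    \<le> 4 * dt * L2_inner \<Omega> (Dt_theta \<theta> dt u n) (at_theta \<theta> u n)"
proof -
  have "(\<lambda>x. ((3 - 2*\<theta>) / (2*dt)) * u n x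
      + 1 * (((4*\<theta> - 4) / (2*dt)) * u (n-1) x + ((1 - 2*\<theta>) / (2*dt)) * u (n-2) x)) \<in> L2 \<Omega>"
    by (intro L2_lincomb mem)
  then have D: "Dt_theta \<theta> dt u n \<in> L2 \<Omega>"
    by (simp add: Dt_theta_def diff_divide_distrib add_divide_distrib algebra_simps)
  have U: "at_theta \<theta> u n \<in> L2 \<Omega>"
    unfolding at_theta_def by (intro L2_lincomb mem)
  have "G_energy \<Omega> \<theta> (u n) (u (n-1)) - G_energy \<Omega> \<theta> (u (n-1)) (u (n-2))
      = (\<integral>x. G_form \<theta> (u n x) (u (n-1) x) - G_form \<theta> (u (n-1) x) (u (n-2) x) \<partial>lebesgue_on \<Omega>)"
    using mem by (simp add: G_energy_def integrable_G_form)
  also have "\<dots> \<le> (\<integral>x. 4 * dt * (Dt_theta \<theta> dt u n x * at_theta \<theta> u n x) \<partial>lebesgue_on \<Omega>)"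
  proof (rule integral_mono)
    show "integrable (lebesgue_on \<Omega>)
        (\<lambda>x. G_form \<theta> (u n x) (u (n-1) x) - G_form \<theta> (u (n-1) x) (u (n-2) x))"
      using mem by (simp add: integrable_G_form)
    show "integrable (lebesgue_on \<Omega>) (\<lambda>x. 4 * dt * (Dt_theta \<theta> dt u n x * at_theta \<theta> u n x))"
      by (intro integrable_mult_right L2_integrable_mult D U)
    show "G_form \<theta> (u n x) (u (n-1) x) - G_form \<theta> (u (n-1) x) (u (n-2) x)
        \<le> 4 * dt * (Dt_theta \<theta> dt u n x * at_theta \<theta> u n x)" for x
    proof -
      \<comment> \<open>The factor \<open>4 * dt\<close> combines the 2 of the pointwise identity
        with the denominator \<open>2 * dt\<close> of the difference quotient.\<close>
      have "4 * dt * (X / (2 * dt) * Z) = 2 * X * Z" for X Z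
        using \<open>0 < dt\<close> by simp
      then show ?thesis
        unfolding Dt_theta_def at_theta_def by (simp only: G_form_increment_le[OF assms(1,2)])
    qed
  qed
  also have "\<dots> = 4 * dt * L2_inner \<Omega> (Dt_theta \<theta> dt u n) (at_theta \<theta> u n)"
    by (simp add: L2_inner_def)
  finally show ?thesis .
qed

text \<open>For Crank-Nicolson the product is a difference of two squares, so the energy balance is
  an exact equality.\<close>

lemma Dt_half_at_half:
  fixes u :: "nat \<Rightarrow> 'a::euclidean_space \<Rightarrow> real"
  assumes "0 < dt" "u 0 \<in> L2 \<Omega>" "u 1 \<in> L2 \<Omega>"
  shows "2 * dt * L2_inner \<Omega> (Dt_half dt u) (at_half u) = (L2_norm \<Omega> (u 1))\<^sup>2 - (L2_norm \<Omega> (u 0))\<^sup>2"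
proof -
  have "2 * dt * L2_inner \<Omega> (Dt_half dt u) (at_half u)
      = (\<integral>x. 2 * dt * (Dt_half dt u x * at_half u x) \<partial>lebesgue_on \<Omega>)"
    by (simp add: L2_inner_def)
  also have "\<dots> = (\<integral>x. u 1 x * u 1 x - u 0 x * u 0 x \<partial>lebesgue_on \<Omega>)"
    using assms(1)
    by (intro Bochner_Integration.integral_cong refl)
      (simp add: Dt_half_def at_half_def field_simps)
  also have "\<dots> = (L2_norm \<Omega> (u 1))\<^sup>2 - (L2_norm \<Omega> (u 0))\<^sup>2"
    using assms by (simp add: L2_norm_power2 L2_inner_def L2_integrable_mult)
  finally show ?thesis .
qed

section \<open>A discrete Gronwall inequality\<close>

text \<open>The recursion is implicit, since \<open>Y (Suc k)\<close> also stands on the right;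
  \<delta> \<le> 1/2 allows it to be absorbed. The free starting index \<open>m\<close> leaves room
  for a separate first step.\<close>

lemma discrete_Gronwall:
  fixes Y R :: "nat \<Rightarrow> real"
  assumes \<delta>: "0 \<le> \<delta>" "\<delta> \<le> 1/2" and "m \<le> n"
    and Y: "\<And>k. m \<le> k \<Longrightarrow> k \<le> n \<Longrightarrow> 0 \<le> Y k" and R: "\<And>k. 0 \<le> R k"
    and step: "\<And>k. m \<le> k \<Longrightarrow> k < n \<Longrightarrow> Y (Suc k) - Y k \<le> \<delta> * (Y (Suc k) + Y k + R (Suc k))"
  shows "Y n \<le> exp (4 * \<delta> * real (n - m)) * (Y m + 2 * \<delta> * (\<Sum>k=Suc m..n. R k))"
  using \<open>m \<le> n\<close> Y step
proof (induction n rule: dec_induct)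
  case base
  then show ?case by simp
next
  case (step n)
  let ?E = "exp (4 * \<delta> * real (n - m))" and ?S = "\<Sum>k=Suc m..n. R k"
  have IH: "Y n \<le> ?E * (Y m + 2 * \<delta> * ?S)"
    using step by simp
  have "(1 - \<delta>) * Y (Suc n) \<le> (1 + \<delta>) * Y n + \<delta> * R (Suc n)"
    using step.prems(2)[of n] step.hyps by (simp add: algebra_simps)
  \<comment> \<open>For \<delta> \<le> 1/2 one has (1 + \<delta>) / (1 - \<delta>) \<le> 1 + 4
    \<delta> and 1 / (1 - \<delta>) \<le> 2; both defects are multiples of \<delta> (1 - 2
    \<delta>).\<close>
  also have "\<dots> \<le> (1 - \<delta>) * ((1 + 4 * \<delta>) * Y n + 2 * \<delta> * R (Suc n))"
  proof -
    have "0 \<le> \<delta> * (1 - 2 * \<delta>)"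
      using \<delta> by simp
    then have "0 \<le> 2 * (\<delta> * (1 - 2 * \<delta>)) * Y n" "0 \<le> \<delta> * (1 - 2 * \<delta>) * R (Suc n)"
      using step.prems(1)[of n] step.hyps R by simp_all
    then show ?thesis
      by (simp add: algebra_simps)
  qed
  finally have "Y (Suc n) \<le> (1 + 4 * \<delta>) * Y n + 2 * \<delta> * R (Suc n)"
    using \<delta> by (simp add: mult_le_cancel_left)
  also have "\<dots> \<le> exp (4 * \<delta>) * (?E * (Y m + 2 * \<delta> * ?S)) + (exp (4 * \<delta>) * ?E) * (2 * \<delta> * R (Suc n))"
  proof (rule add_mono[OF mult_mono[OF exp_ge_add_one_self IH]])
    \<comment> \<open>The newest datum is inflated by the whole exponential factor, which can then
      be taken out of the extended sum.\<close>
    have "1 \<le> exp (4 * \<delta> + 4 * \<delta> * real (n - m))"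
      using \<delta> by simp
    then have "1 * (2 * \<delta> * R (Suc n)) \<le> (exp (4 * \<delta>) * ?E) * (2 * \<delta> * R (Suc n))"
      using \<delta> R[of "Suc n"] unfolding exp_add by (intro mult_right_mono) auto
    then show "2 * \<delta> * R (Suc n) \<le> (exp (4 * \<delta>) * ?E) * (2 * \<delta> * R (Suc n))"
      by simp
  qed (use step.prems(1)[of n] step.hyps in auto)
  also have "\<dots> = (exp (4 * \<delta>) * ?E) * (Y m + 2 * \<delta> * (\<Sum>k=Suc m..Suc n. R k))"
    using step.hyps by (simp add: algebra_simps)
  also have "exp (4 * \<delta>) * ?E = exp (4 * \<delta> * real (Suc n - m))"
    using step.hyps by (simp add: Suc_diff_le algebra_simps flip: exp_add)
  finally show ?case .
qed

section \<open>Energy estimates for a single time step\<close>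

text \<open>Testing with the averages of \<open>u\<close> and \<open>\<sigma>\<close> leaves two
  nonnegative dissipation terms, which are dropped: the dissipation sums in the final estimate begin
  at \<open>k=2\<close>, so only \<open>u 1\<close> has to be controlled here.\<close>

lemma MFE_first_step:
  fixes u \<sigma> :: "nat \<Rightarrow> 'a::euclidean_space \<Rightarrow> real"
  assumes fe: "fe_space \<Omega> h L" and sol: "MFE_solution \<Omega> L \<theta> \<gamma> f g dt N u \<sigma>"
    and "0 < N" "0 < dt" "0 < \<gamma>"
    and lip: "\<And>a b. \<bar>f a - f b\<bar> \<le> K * \<bar>a - b\<bar>" and f0: "f 0 = 0"
    and g: "\<And>k. k \<le> N \<Longrightarrow> at_times g dt k \<in> L2 \<Omega>"
  shows "(L2_norm \<Omega> (u 1))\<^sup>2 - (L2_norm \<Omega> (u 0))\<^sup>2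
    \<le> 2 * dt * ((K + 1) * ((L2_norm \<Omega> (u 1))\<^sup>2 + (L2_norm \<Omega> (u 0))\<^sup>2
        + (L2_norm \<Omega> (at_times g dt 1))\<^sup>2 + (L2_norm \<Omega> (at_times g dt 0))\<^sup>2))"
proof -
  \<comment> \<open>With the weights \<open>1 - 1/2\<close> and \<open>1/2\<close> the average has
    the shape of the \<theta>-lemmas at \<theta> = 1/2.\<close>
  have half: "at_half \<phi> = (\<lambda>x. (1 - 1/2) * \<phi> 1 x + 1/2 * \<phi> 0 x)" for \<phi> :: "nat \<Rightarrow> 'a \<Rightarrow> real"
    by (simp add: at_half_def add_divide_distrib)
  have mem: "u 0 \<in> L" "u 1 \<in> L" "\<sigma> 0 \<in> L" "\<sigma> 1 \<in> L"
    using sol \<open>0 < N\<close> by (auto simp: MFE_solution_def)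
  have test: "at_half u \<in> L" "at_half \<sigma> \<in> L"
    unfolding half by (intro fe_space_lincomb[OF fe] mem)+
  have uL2: "u 0 \<in> L2 \<Omega>" "u 1 \<in> L2 \<Omega>"
    using fe_space_subset_L2[OF fe] mem by auto
  let ?a = "L2_inner \<Omega> (grad \<Omega> (at_half \<sigma>)) (grad \<Omega> (at_half u))"
  have 1: "L2_inner \<Omega> (Dt_half dt u) (at_half u) - \<gamma> * ?a
      + L2_inner \<Omega> (grad \<Omega> (at_half u)) (grad \<Omega> (at_half u))
      + L2_inner \<Omega> (at_half (\<lambda>n. f \<circ> u n)) (at_half u)
    = L2_inner \<Omega> (at_half (at_times g dt)) (at_half u)"
    using sol test unfolding MFE_solution_def by blast
  have "L2_inner \<Omega> (at_half \<sigma>) (at_half \<sigma>)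
      + L2_inner \<Omega> (grad \<Omega> (at_half u)) (grad \<Omega> (at_half \<sigma>)) = 0"
    using sol test unfolding MFE_solution_def by blast
  then have "?a = - (L2_norm \<Omega> (at_half \<sigma>))\<^sup>2"
    by (simp add: L2_norm_power2 L2_inner_commute[of \<Omega> "grad \<Omega> (at_half \<sigma>)"])
  then have a: "- \<gamma> * ?a \<ge> 0"
    using \<open>0 < \<gamma>\<close> by simp
  have "L2_inner \<Omega> (grad \<Omega> (at_half u)) (grad \<Omega> (at_half u)) \<ge> 0"
    by (simp flip: L2_norm_power2)
  moreover have "L2_inner \<Omega> (at_half (at_times g dt)) (at_half u)
      - L2_inner \<Omega> (at_half (\<lambda>n. f \<circ> u n)) (at_half u)
    \<le> (K + 1) * ((L2_norm \<Omega> (u 1))\<^sup>2 + (L2_norm \<Omega> (u 0))\<^sup>2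
        + (L2_norm \<Omega> (at_times g dt 1))\<^sup>2 + (L2_norm \<Omega> (at_times g dt 0))\<^sup>2)"
    unfolding half using \<open>0 < N\<close> by (intro source_integral_le lip f0 uL2 g) auto
  ultimately have "L2_inner \<Omega> (Dt_half dt u) (at_half u)
    \<le> (K + 1) * ((L2_norm \<Omega> (u 1))\<^sup>2 + (L2_norm \<Omega> (u 0))\<^sup>2
        + (L2_norm \<Omega> (at_times g dt 1))\<^sup>2 + (L2_norm \<Omega> (at_times g dt 0))\<^sup>2)"
    using 1 a by simp
  then show ?thesis
    unfolding Dt_half_at_half[OF \<open>0 < dt\<close> uL2, symmetric]
    using \<open>0 < dt\<close> by (intro mult_left_mono) auto
qed

text \<open>The energy argument of the first step with the dissipation retained, and with
  G-stability replacing the difference of squares.\<close>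

lemma MFE_step:
  fixes u \<sigma> :: "nat \<Rightarrow> 'a::euclidean_space \<Rightarrow> real"
  assumes fe: "fe_space \<Omega> h L" and sol: "MFE_solution \<Omega> L \<theta> \<gamma> f g dt N u \<sigma>"
    and n: "2 \<le> n" "n \<le> N" and "0 < dt" and \<theta>: "0 \<le> \<theta>" "\<theta> \<le> 1/2"
    and lip: "\<And>a b. \<bar>f a - f b\<bar> \<le> K * \<bar>a - b\<bar>" and f0: "f 0 = 0"
    and g: "\<And>k. k \<le> N \<Longrightarrow> at_times g dt k \<in> L2 \<Omega>"
  shows "G_energy \<Omega> \<theta> (u n) (u (n-1)) - G_energy \<Omega> \<theta> (u (n-1)) (u (n-2))
      + 4 * dt * ((L2_norm \<Omega> (grad \<Omega> (at_theta \<theta> u n)))\<^sup>2 + \<gamma> * (L2_norm \<Omega> (at_theta \<theta> \<sigma> n))\<^sup>2)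
    \<le> 4 * dt * ((K + 1) * ((L2_norm \<Omega> (u n))\<^sup>2 + (L2_norm \<Omega> (u (n-1)))\<^sup>2
        + (L2_norm \<Omega> (at_times g dt n))\<^sup>2 + (L2_norm \<Omega> (at_times g dt (n-1)))\<^sup>2))"
proof -
  have mem: "u k \<in> L" "\<sigma> k \<in> L" if "k \<le> N" for k
    using sol that by (auto simp: MFE_solution_def)
  have test: "at_theta \<theta> u n \<in> L" "at_theta \<theta> \<sigma> n \<in> L"
    unfolding at_theta_def using n by (intro fe_space_lincomb[OF fe] mem; simp)+
  have uL2: "u n \<in> L2 \<Omega>" "u (n-1) \<in> L2 \<Omega>" "u (n-2) \<in> L2 \<Omega>"
    using fe_space_subset_L2[OF fe] mem n by (auto simp: subset_eq)
  let ?a = "L2_inner \<Omega> (grad \<Omega> (at_theta \<theta> \<sigma> n)) (grad \<Omega> (at_theta \<theta> u n))"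
  let ?R = "(K + 1) * ((L2_norm \<Omega> (u n))\<^sup>2 + (L2_norm \<Omega> (u (n-1)))\<^sup>2
        + (L2_norm \<Omega> (at_times g dt n))\<^sup>2 + (L2_norm \<Omega> (at_times g dt (n-1)))\<^sup>2)"
  have 1: "L2_inner \<Omega> (Dt_theta \<theta> dt u n) (at_theta \<theta> u n) - \<gamma> * ?a
      + L2_inner \<Omega> (grad \<Omega> (at_theta \<theta> u n)) (grad \<Omega> (at_theta \<theta> u n))
      + L2_inner \<Omega> (at_theta \<theta> (\<lambda>m. f \<circ> u m) n) (at_theta \<theta> u n)
    = L2_inner \<Omega> (at_theta \<theta> (at_times g dt) n) (at_theta \<theta> u n)"
    using sol test n unfolding MFE_solution_def by simp
  have "L2_inner \<Omega> (at_theta \<theta> \<sigma> n) (at_theta \<theta> \<sigma> n)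
      + L2_inner \<Omega> (grad \<Omega> (at_theta \<theta> u n)) (grad \<Omega> (at_theta \<theta> \<sigma> n)) = 0"
    using sol test n unfolding MFE_solution_def by simp
  \<comment> \<open>Both equations contain gradients of the averaged functions, so the coupling
    terms agree by symmetry and \<open>- \<gamma> * ?a\<close> becomes the dissipation of
    \<sigma>.\<close>
  then have a: "?a = - (L2_norm \<Omega> (at_theta \<theta> \<sigma> n))\<^sup>2"
    by (simp add: L2_norm_power2 L2_inner_commute[of \<Omega> "grad \<Omega> (at_theta \<theta> \<sigma> n)"])
  have "L2_inner \<Omega> (at_theta \<theta> (at_times g dt) n) (at_theta \<theta> u n)
      - L2_inner \<Omega> (at_theta \<theta> (\<lambda>m. f \<circ> u m) n) (at_theta \<theta> u n) \<le> ?R"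
    unfolding at_theta_def using n \<theta> by (intro source_integral_le lip f0 uL2 g) auto
  then have "L2_inner \<Omega> (Dt_theta \<theta> dt u n) (at_theta \<theta> u n)
      + ((L2_norm \<Omega> (grad \<Omega> (at_theta \<theta> u n)))\<^sup>2 + \<gamma> * (L2_norm \<Omega> (at_theta \<theta> \<sigma> n))\<^sup>2) \<le> ?R"
    using 1 unfolding a by (simp add: L2_norm_power2)
  then have "4 * dt * (L2_inner \<Omega> (Dt_theta \<theta> dt u n) (at_theta \<theta> u n)
      + ((L2_norm \<Omega> (grad \<Omega> (at_theta \<theta> u n)))\<^sup>2 + \<gamma> * (L2_norm \<Omega> (at_theta \<theta> \<sigma> n))\<^sup>2)) \<le> 4 * dt * ?R"
    using \<open>0 < dt\<close> by (intro mult_left_mono) auto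
  then show ?thesis
    using G_energy_increment_le[OF \<theta> \<open>0 < dt\<close> uL2] by (simp only: distrib_left)
qed

section \<open>Stability over all time steps\<close>

lemma MFE_stability:
  fixes u \<sigma> :: "nat \<Rightarrow> 'a::euclidean_space \<Rightarrow> real"
  assumes fe: "fe_space \<Omega> h L" and sol: "MFE_solution \<Omega> L \<theta> \<gamma> f g dt N u \<sigma>"
    and n: "2 \<le> n" "n \<le> N" and "0 < dt" "0 < \<gamma>" and \<theta>: "0 \<le> \<theta>" "\<theta> \<le> 1/2"
    and lip: "\<And>a b. \<bar>f a - f b\<bar> \<le> K * \<bar>a - b\<bar>" and f0: "f 0 = 0"
    and g: "\<And>k. k \<le> N \<Longrightarrow> at_times g dt k \<in> L2 \<Omega>"
    and dt: "8 * (K + 1) * dt \<le> 1"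
  shows "(L2_norm \<Omega> (u n))\<^sup>2
      + dt * (\<Sum>k=2..n. (L2_norm \<Omega> (grad \<Omega> (at_theta \<theta> u k)))\<^sup>2)
      + \<gamma> * dt * (\<Sum>k=2..n. (L2_norm \<Omega> (at_theta \<theta> \<sigma> k))\<^sup>2)
    \<le> exp (16 * (K + 1) * (real n * dt)) * (72 * (K + 1)) * ((L2_norm \<Omega> (u 0))\<^sup>2
        + dt * (\<Sum>k=0..n. (L2_norm \<Omega> (at_times g dt k))\<^sup>2))"
proof -
  define x where "x k = (L2_norm \<Omega> (u k))\<^sup>2" for k
  define G where "G k = (L2_norm \<Omega> (at_times g dt k))\<^sup>2" for k
  define D where "D k = (L2_norm \<Omega> (grad \<Omega> (at_theta \<theta> u k)))\<^sup>2
    + \<gamma> * (L2_norm \<Omega> (at_theta \<theta> \<sigma> k))\<^sup>2" for k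
  define H where "H k = G_energy \<Omega> \<theta> (u k) (u (k-1))" for k
  \<comment> \<open>The accumulated dissipation is part of the Gronwall quantity, so energy and
    dissipation are bounded at once. For \<open>k=1\<close> the sum is empty and
    \<open>Y 1 = H 1\<close>.\<close>
  define Y where "Y k = H k + 4 * dt * (\<Sum>j=2..k. D j)" for k
  \<comment> \<open>The factor in front of the source terms in \<open>MFE_step\<close>; the
    step-size hypothesis says exactly \<delta> \<le> 1/2.\<close>
  define \<delta> where "\<delta> = 4 * dt * (K + 1)"
  have K: "0 \<le> K"
    using lip[of 1 0] by simp
  have \<delta>: "0 \<le> \<delta>" "\<delta> \<le> 1/2"
    using K \<open>0 < dt\<close> dt by (auto simp: \<delta>_def algebra_simps)
  have D: "0 \<le> D k" and G: "0 \<le> G k" and x: "0 \<le> x k" for k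
    using \<open>0 < \<gamma>\<close> by (auto simp: D_def G_def x_def)
  have uL2: "u k \<in> L2 \<Omega>" if "k \<le> N" for k
    using fe_space_subset_L2[OF fe] sol that by (auto simp: MFE_solution_def)
  have xH: "x k \<le> H k" if "k \<le> N" for k
    unfolding x_def H_def using that by (intro G_energy_ge \<theta> uL2) auto
  have xY: "x k \<le> Y k" and HY: "H k \<le> Y k" if "k \<le> N" for k
    using xH[OF that] D \<open>0 < dt\<close> by (auto simp: Y_def sum_nonneg intro: add_increasing2)
  have step: "Y (Suc k) - Y k \<le> \<delta> * (Y (Suc k) + Y k + (G (Suc k) + G k))"
    if "1 \<le> k" "k < n" for k
  proof -
    have "Y (Suc k) - Y k = H (Suc k) - H k + 4 * dt * D (Suc k)"
      using that by (simp add: Y_def distrib_left)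
    also have "\<dots> \<le> \<delta> * (x (Suc k) + x k + G (Suc k) + G k)"
      using MFE_step[OF fe sol _ _ \<open>0 < dt\<close> \<theta> lip f0 g, of "Suc k"] that n
      by (simp add: H_def D_def x_def G_def \<delta>_def mult.assoc numeral_2_eq_2)
    \<comment> \<open>Replacing the squared norms by the larger \<open>Y\<close> closes the
      recursion.\<close>
    also have "\<dots> \<le> \<delta> * (Y (Suc k) + Y k + (G (Suc k) + G k))"
      using xY[of "Suc k"] xY[of k] that n \<delta> by (intro mult_left_mono) auto
    finally show ?thesis .
  qed
  have "x 1 - x 0 \<le> 2 * dt * ((K + 1) * (x 1 + x 0 + G 1 + G 0))"
    unfolding x_def G_def using n \<open>0 < dt\<close> \<open>0 < \<gamma>\<close>
    by (intro MFE_first_step[OF fe sol] lip f0 g) auto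
  also have "\<dots> \<le> \<delta> * (x 1 + x 0 + G 1 + G 0)"
    using x G K \<open>0 < dt\<close> by (simp add: \<delta>_def mult.assoc)
  \<comment> \<open>The unknown \<open>x 1\<close> is absorbed using \<delta> \<le> 1/2, which
    doubles the right-hand side and gives the constants 3 and 2 below.\<close>
  finally have "(1 - \<delta>) * x 1 \<le> (1 + \<delta>) * x 0 + \<delta> * (G 0 + G 1)"
    by (simp add: algebra_simps)
  moreover have "1/2 * x 1 \<le> (1 - \<delta>) * x 1" "(1 + \<delta>) * x 0 \<le> 3/2 * x 0"
    using \<delta> x by (intro mult_right_mono; simp)+
  ultimately have x1: "x 1 \<le> 3 * x 0 + 2 * (\<delta> * (G 0 + G 1))"
    by linarith
  have "Y 1 = H 1"
    by (simp add: Y_def)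
  also have "H 1 \<le> 7 * (x 1 + x 0)"
    unfolding H_def x_def using n \<theta> uL2 G_energy_le[of \<theta> "u 1" \<Omega> "u 0"] by simp
  \<comment> \<open>Here 28 = 7 * (3 + 1) and 14 = 7 * 2.\<close>
  finally have Y1: "Y 1 \<le> 28 * x 0 + 14 * (\<delta> * (G 0 + G 1))"
    using x1 by simp
  let ?S = "\<Sum>k=0..n. G k"
  have S01: "G 0 + G 1 \<le> ?S"
  proof -
    have "(\<Sum>k\<in>{0,1}. G k) \<le> ?S"
      using n G by (intro sum_mono2) auto
    then show ?thesis by simp
  qed
  have S: "(\<Sum>k=Suc 1..n. G k + G (k-1)) \<le> 2 * ?S"
  proof -
    \<comment> \<open>Each source value occurs at most twice, once per neighbouring step; the shift
      is injective because all indices are positive.\<close>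
    have "(\<Sum>k=Suc 1..n. G (k-1)) = (\<Sum>k\<in>(\<lambda>k. k-1) ` {Suc 1..n}. G k)"
      by (subst sum.reindex) (auto simp: inj_on_def)
    also have "\<dots> \<le> ?S"
      using G by (intro sum_mono2) auto
    finally have "(\<Sum>k=Suc 1..n. G (k-1)) \<le> ?S" .
    moreover have "(\<Sum>k=Suc 1..n. G k) \<le> ?S"
      using G by (intro sum_mono2) auto
    ultimately show ?thesis
      by (simp add: sum.distrib)
  qed
  have "Y n \<le> exp (4 * \<delta> * real (n - 1)) * (Y 1 + 2 * \<delta> * (\<Sum>k=Suc 1..n. G k + G (k-1)))"
  proof (rule discrete_Gronwall[OF \<delta>])
    show "0 \<le> Y k" if "1 \<le> k" "k \<le> n" for k
      using x[of k] xY[of k] that n by simp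
  qed (use n G step in auto)
  also have "\<dots> \<le> exp (16 * (K + 1) * (real n * dt)) * (72 * (K + 1) * (x 0 + dt * ?S))"
  proof (rule mult_mono)
    have "4 * \<delta> * real (n - 1) \<le> 4 * \<delta> * real n"
      using \<delta> by (intro mult_left_mono) auto
    then show "exp (4 * \<delta> * real (n - 1)) \<le> exp (16 * (K + 1) * (real n * dt))"
      by (simp add: \<delta>_def algebra_simps)
    have "\<delta> * (G 0 + G 1) \<le> \<delta> * ?S"
      "\<delta> * (\<Sum>k=Suc 1..n. G k + G (k-1)) \<le> \<delta> * (2 * ?S)"
      using S01 S \<delta>(1) by (intro mult_left_mono; simp)+
    \<comment> \<open>The 18 is 14 from the starting value plus 2 * 2 from the Gronwall sum;
      inserting \<delta> turns it into the factor 72 = 18 * 4, which also covers 28.\<close>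
    then have "Y 1 + 2 * \<delta> * (\<Sum>k=Suc 1..n. G k + G (k-1)) \<le> 28 * x 0 + 18 * (\<delta> * ?S)"
      using Y1 by (simp only: mult.assoc mult.left_commute)
    also have "\<dots> \<le> 72 * (K + 1) * (x 0 + dt * ?S)"
      using x[of 0] K by (simp add: \<delta>_def algebra_simps add_increasing)
    finally show "Y 1 + 2 * \<delta> * (\<Sum>k=Suc 1..n. G k + G (k-1)) \<le> 72 * (K + 1) * (x 0 + dt * ?S)" .
    have "0 \<le> Y 1"
      using x[of 1] xY[of 1] n by simp
    then show "0 \<le> Y 1 + 2 * \<delta> * (\<Sum>k=Suc 1..n. G k + G (k-1))"
      using \<delta> G by (simp add: sum_nonneg)
  qed simp
  finally have "Y n \<le> exp (16 * (K + 1) * (real n * dt)) * (72 * (K + 1)) * (x 0 + dt * ?S)"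
    by (simp add: mult.assoc)
  \<comment> \<open>Of the coefficient \<open>4 * dt\<close> in \<open>Y\<close>, a single
    \<open>dt\<close> is kept.\<close>
  moreover have "x n + dt * (\<Sum>k=2..n. D k) \<le> Y n"
    using xH[of n] n D \<open>0 < dt\<close> by (simp add: Y_def sum_nonneg add_mono mult_right_mono)
  ultimately show ?thesis
    by (simp add: x_def G_def D_def sum.distrib sum_distrib_left algebra_simps)
qed

text \<open>The source sum starts at \<open>k=0\<close> because the Crank-Nicolson average contains
  \<open>g\<close> at time zero. The condition \<open>f 0 = 0\<close> makes zero a solution for zero
  data, matching a right-hand side without constant term. The threshold \<tau> comes from absorbing
  the implicit contributions at the new time level. Independence of the discretisation is expressed
  by choosing \<open>C\<close> and \<tau> before \<open>h\<close>, \<open>L\<close> and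
  \<open>N\<close>.\<close>

theorem theorem3p1:
  fixes \<Omega> :: "'a::euclidean_space set" and T \<gamma> \<theta> Cf :: real and f :: "real \<Rightarrow> real"
  assumes "DIM('a) \<le> 2" and "convex_polygonal_domain \<Omega>"
    and "0 < T" and "0 < \<gamma>" and "0 \<le> \<theta>" and "\<theta> \<le> 1/2"
    and "\<And>a b. \<bar>f a - f b\<bar> \<le> Cf * \<bar>a - b\<bar>" and "f 0 = 0"
  shows "\<exists>C>0. \<exists>\<tau>>0. \<forall>h L N g u \<sigma>.
    fe_space \<Omega> h L \<longrightarrow> 0 < N \<longrightarrow> T / real N \<le> \<tau> \<longrightarrow>
    (\<forall>t\<in>{0..T}. (\<lambda>x. g x t) \<in> L2 \<Omega>) \<longrightarrow>
    MFE_solution \<Omega> L \<theta> \<gamma> f g (T / real N) N u \<sigma> \<longrightarrow>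
    (\<forall>n. 2 \<le> n \<and> n \<le> N \<longrightarrow>
      (L2_norm \<Omega> (u n))\<^sup>2
        + T / real N * (\<Sum>k=2..n. (L2_norm \<Omega> (grad \<Omega> (at_theta \<theta> u k)))\<^sup>2)
        + \<gamma> * (T / real N) * (\<Sum>k=2..n. (L2_norm \<Omega> (at_theta \<theta> \<sigma> k))\<^sup>2)
      \<le> C * ((L2_norm \<Omega> (u 0))\<^sup>2
             + T / real N * (\<Sum>k=0..n. (L2_norm \<Omega> (at_times g (T / real N) k))\<^sup>2)))"
proof -
  have K: "0 \<le> Cf"
    using assms(7)[of 1 0] by simp
  define C where "C = exp (16 * (Cf + 1) * T) * (72 * (Cf + 1))"
  \<comment> \<open>The second number is the witness for \<tau>, equivalent to the step-size
    hypothesis of \<open>MFE_stability\<close>.\<close>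
  have "0 < C" "0 < 1 / (8 * (Cf + 1))"
    using K by (simp_all add: C_def)
  moreover have "(L2_norm \<Omega> (u n))\<^sup>2
        + T / real N * (\<Sum>k=2..n. (L2_norm \<Omega> (grad \<Omega> (at_theta \<theta> u k)))\<^sup>2)
        + \<gamma> * (T / real N) * (\<Sum>k=2..n. (L2_norm \<Omega> (at_theta \<theta> \<sigma> k))\<^sup>2)
      \<le> C * ((L2_norm \<Omega> (u 0))\<^sup>2
             + T / real N * (\<Sum>k=0..n. (L2_norm \<Omega> (at_times g (T / real N) k))\<^sup>2))"
    if fe: "fe_space \<Omega> h L" and N: "0 < N" and dt: "T / real N \<le> 1 / (8 * (Cf + 1))"
      and g: "\<forall>t\<in>{0..T}. (\<lambda>x. g x t) \<in> L2 \<Omega>"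
      and sol: "MFE_solution \<Omega> L \<theta> \<gamma> f g (T / real N) N u \<sigma>" and n: "2 \<le> n" "n \<le> N"
    for h L N g u \<sigma> n
  proof -
    let ?dt = "T / real N"
    let ?B = "(L2_norm \<Omega> (u 0))\<^sup>2 + ?dt * (\<Sum>k=0..n. (L2_norm \<Omega> (at_times g ?dt k))\<^sup>2)"
    \<comment> \<open>Grid times stay in [0, T]: there \<open>g\<close> is square integrable, and
      the exponent is bounded independently of \<open>n\<close>.\<close>
    have time: "real k * ?dt \<le> T" if "k \<le> N" for k
      using that N \<open>0 < T\<close> by (simp add: field_simps)
    have "at_times g ?dt k \<in> L2 \<Omega>" if "k \<le> N" for k
      unfolding at_times_def using time[OF that] \<open>0 < T\<close> by (intro g[rule_format]) simp
    moreover have "8 * (Cf + 1) * ?dt \<le> 1"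
      using mult_left_mono[OF dt, of "8 * (Cf + 1)"] K by simp
    ultimately have "(L2_norm \<Omega> (u n))\<^sup>2
        + ?dt * (\<Sum>k=2..n. (L2_norm \<Omega> (grad \<Omega> (at_theta \<theta> u k)))\<^sup>2)
        + \<gamma> * ?dt * (\<Sum>k=2..n. (L2_norm \<Omega> (at_theta \<theta> \<sigma> k))\<^sup>2)
      \<le> exp (16 * (Cf + 1) * (real n * ?dt)) * (72 * (Cf + 1)) * ?B"
      using N \<open>0 < T\<close> by (intro MFE_stability[OF fe sol n] assms) auto
    also have "\<dots> \<le> C * ?B"
    proof (rule mult_right_mono)
      have "16 * (Cf + 1) * (real n * ?dt) \<le> 16 * (Cf + 1) * T"
        using time[OF n(2)] K by (intro mult_left_mono) auto
      then show "exp (16 * (Cf + 1) * (real n * ?dt)) * (72 * (Cf + 1)) \<le> C"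
        unfolding C_def using K by (intro mult_right_mono) auto
      show "0 \<le> ?B"
        using \<open>0 < T\<close> by (intro add_nonneg_nonneg mult_nonneg_nonneg sum_nonneg) auto
    qed
    finally show ?thesis .
  qed
  ultimately show ?thesis
    by blast
qed

end
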